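(* Let $E$ be a uniformly convex real Banach space, let $K$ be a nonempty closed convex subset of $E$, and let $T_i:K\to K$, $i=1,2,\dots,m$, be $m$ total asymptotically nonexpansive mappings with sequences $\{\mu_{in}\}_{n\ge1},\{l_{in}\}_{n\ge1}\subset[0,\infty)$ and functions $\phi_i:[0,\infty)\to[0,\infty)$, such that $\sum_{n=1}^\infty\mu_{in}<\infty$ and $\sum_{n=1}^\infty l_{in}<\infty$ for $i=1,2,\dots,m$, and such that $F:=\bigcap_{i=1}^m F(T_i)\neq\emptyset$. Let $\{\alpha_{in}\}_{n\ge1}$, $i=0,1,\dots,m$, be sequences in $(\gamma_1,\gamma_2)$, for some $\gamma_1,\gamma_2\in(0,1)$, such that $\sum_{i=0}^m\alpha_{in}=1$ for every $n\ge1$. From arbitrary $x_1\in K$ define the sequence $\{x_n\}$ by $$x_{n+1}=\alpha_{0n}x_n+\sum_{i=1}^m\alpha_{in}T_i^nx_n,\qquad n\ge1.$$ Suppose that there exist $M_i,M_i^*>0$ such that $\phi_i(\lambda_i)\le M_i^*\lambda_i$ whenever $\lambda_i\ge M_i$, $i=1,2,\dots,m$. Then $$\lim_{n\to\infty}\|x_n-T_i^nx_n\|=0,\qquad i=1,2,\dots,m.$$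
   Context: Let $K$ be a nonempty subset of a real normed space. A mapping $T:K\to K$ is total asymptotically nonexpansive, with sequences $\{\mu_n\}_{n\ge1}$, $\{l_n\}_{n\ge1}$ and function $\phi$, if $\{\mu_n\}$ and $\{l_n\}$ are nonnegative real sequences with $\mu_n\to0$ and $l_n\to0$ as $n\to\infty$, $\phi:[0,\infty)\to[0,\infty)$ is a strictly increasing continuous function with $\phi(0)=0$, and $$\|T^nx-T^ny\|\le\|x-y\|+\mu_n\phi(\|x-y\|)+l_n\quad\text{for all }x,y\in K,\ n\ge1.$$ $T^n$ denotes the $n$-th iterate of $T$, and $F(T)=\{x\in K: Tx=x\}$ denotes the set of fixed points of $T$. *)

theory Defs
  imports "HOL-Analysis.Analysis"
begin

(* Clarkson's definition, with unit vectors (equivalently: positive modulus of convexity on (0,2]). *)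
class uniformly_convex_space = real_normed_vector +
  assumes uniformly_convex:
    "\<forall>\<epsilon>::real. 0 < \<epsilon> \<and> \<epsilon> \<le> 2 \<longrightarrow>
       (\<exists>\<delta>>0. \<forall>x y. norm x = 1 \<and> norm y = 1 \<and> norm (x - y) \<ge> \<epsilon> \<longrightarrow>
          norm (scaleR (1 / 2) (x + y)) \<le> 1 - \<delta>)"

(* The values \<mu> 0 and l 0, and the values of \<phi> at negative arguments, are unconstrained junk:
   sequences are indexed from 1 and \<phi> is a function on [0,\<infinity>). *)
definition total_asymptotically_nonexpansive ::
  "'a::real_normed_vector set \<Rightarrow> ('a \<Rightarrow> 'a) \<Rightarrow> (nat \<Rightarrow> real) \<Rightarrow> (nat \<Rightarrow> real) \<Rightarrow> (real \<Rightarrow> real) \<Rightarrow> bool"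
where
  "total_asymptotically_nonexpansive K T \<mu> l \<phi> \<longleftrightarrow>
     T \<in> K \<rightarrow> K \<and>
     (\<forall>n\<ge>1. 0 \<le> \<mu> n) \<and> (\<forall>n\<ge>1. 0 \<le> l n) \<and>
     \<mu> \<longlonglongrightarrow> 0 \<and> l \<longlonglongrightarrow> 0 \<and>
     \<phi> \<in> {0..} \<rightarrow> {0..} \<and> strict_mono_on {0..} \<phi> \<and> continuous_on {0..} \<phi> \<and> \<phi> 0 = 0 \<and>
     (\<forall>x\<in>K. \<forall>y\<in>K. \<forall>n\<ge>1.
        norm ((T ^^ n) x - (T ^^ n) y) \<le> norm (x - y) + \<mu> n * \<phi> (norm (x - y)) + l n)"

definition fixed_points :: "'a set \<Rightarrow> ('a \<Rightarrow> 'a) \<Rightarrow> 'a set" where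
  "fixed_points K T = {x \<in> K. T x = x}"

end

theory Submission
  imports Defs
begin

text \<open>
  Fix a common fixed point \<open>p\<close> and put \<open>a n = norm (x n - p)\<close>. Since each \<open>\<phi> i\<close> is monotone and grows at
  most linearly at infinity, it is bounded by an affine function, so every \<open>(T i ^^ n) (x n)\<close>
  lies within \<open>R n = (1 + b n) * a n + c n\<close> of \<open>p\<close>, where \<open>b\<close> and \<open>c\<close> are summable. The convex
  combination \<open>x (Suc n)\<close> does too, and the recursion \<open>a (Suc n) \<le> (1 + b n) * a n + c n\<close> forces \<open>a n\<close>
  to converge to some \<open>r\<close> (lemma \<open>convergent_if_quasi_decreasing\<close>); then \<open>R n\<close> tends to \<open>r\<close> as well.

  The points averaged to give \<open>x (Suc n)\<close> thus have distance at most \<open>R n \<longlonglongrightarrow> r\<close> from \<open>p\<close>, while their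
  average has distance \<open>a (Suc n) \<longlonglongrightarrow> r\<close>: asymptotically no length is lost by averaging. As all weights
  exceed \<open>\<gamma>\<^sub>1 > 0\<close>, no length is lost either in the plain midpoint of any two of these points, in
  particular of \<open>x n\<close> and \<open>(T i ^^ n) (x n)\<close> (lemma \<open>norm_convex_combination_le_pair\<close>). Uniform
  convexity, in the sequential form \<open>uniformly_convex_sequences\<close>, then makes the two merge.
\<close>

section \<open>Sequences that decrease up to summable errors\<close>

text \<open>
  Unrolling the recursion and using \<open>1 + t \<le> exp t\<close> bounds \<open>a\<close>. Once \<open>a\<close> is bounded, the
  multiplicative error \<open>b n * a n\<close> becomes an additive summable error \<open>d n\<close>, and subtracting the
  partial sums of \<open>d\<close> from \<open>a\<close> leaves a decreasing sequence that is bounded below.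
\<close>
lemma convergent_if_quasi_decreasing:
  fixes a b c :: "nat \<Rightarrow> real"
  assumes a: "\<And>n. 0 \<le> a n" and b: "\<And>n. 0 \<le> b n" and c: "\<And>n. 0 \<le> c n"
    and step: "\<And>n. a (Suc n) \<le> (1 + b n) * a n + c n"
    and "summable b" and "summable c"
  shows "convergent a"
proof -
  have "a n \<le> exp (\<Sum>k<n. b k) * (a 0 + (\<Sum>k<n. c k))" for n
  proof (induction n)
    case 0
    show ?case by simp
  next
    case (Suc n)
    let ?B = "\<Sum>k<n. b k" and ?C = "a 0 + (\<Sum>k<n. c k)"
    have "0 \<le> ?B" "0 \<le> ?C" using a b c by (simp_all add: sum_nonneg)
    have "a (Suc n) \<le> (1 + b n) * a n + c n" by (rule step)
    also have "\<dots> \<le> exp (b n) * (exp ?B * ?C) + exp (b n + ?B) * c n"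
    proof (rule add_mono)
      show "(1 + b n) * a n \<le> exp (b n) * (exp ?B * ?C)"
        using Suc a[of n] by (intro mult_mono) auto
      have "1 \<le> exp (b n + ?B)" using \<open>0 \<le> ?B\<close> b[of n] by simp
      from mult_right_mono[OF this c[of n]] show "c n \<le> exp (b n + ?B) * c n" by simp
    qed
    also have "\<dots> = exp (\<Sum>k<Suc n. b k) * (a 0 + (\<Sum>k<Suc n. c k))"
      by (simp add: exp_add algebra_simps)
    finally show ?case .
  qed
  also have "exp (\<Sum>k<n. b k) * (a 0 + (\<Sum>k<n. c k)) \<le> exp (suminf b) * (a 0 + suminf c)" for n
    using assms by (intro mult_mono add_mono iffD2[OF exp_le_cancel_iff] sum_le_suminf)
      (auto intro!: add_nonneg_nonneg sum_nonneg)
  finally obtain A where A: "a n \<le> A" for n by blast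
  define d where "d n = b n * A + c n" for n
  have "0 \<le> A" using a[of 0] A[of 0] by simp
  then have d: "0 \<le> d n" for n using b c by (simp add: d_def)
  have "summable d" unfolding d_def using assms by (intro summable_add summable_mult2)
  have a_step: "a (Suc n) \<le> a n + d n" for n
    using step[of n] mult_left_mono[OF A[of n] b[of n]] by (simp add: d_def algebra_simps)
  define g where "g n = a n - (\<Sum>k<n. d k)" for n
  have "decseq g" using a_step by (intro decseq_SucI) (simp add: g_def algebra_simps)
  moreover have "- suminf d \<le> g n" for n
    using sum_le_suminf[OF \<open>summable d\<close>, of "{..<n}"] d a[of n] by (simp add: g_def)
  ultimately obtain L where "g \<longlonglongrightarrow> L" by (metis decseq_convergent)
  moreover have "(\<lambda>n. \<Sum>k<n. d k) \<longlonglongrightarrow> suminf d" by (rule summable_LIMSEQ[OF \<open>summable d\<close>])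
  ultimately have "(\<lambda>n. g n + (\<Sum>k<n. d k)) \<longlonglongrightarrow> L + suminf d" by (rule tendsto_add)
  then show ?thesis unfolding g_def convergent_def by auto
qed

section \<open>Averages and uniform convexity\<close>

text \<open>
  Remove the weight \<open>c\<close> from each of \<open>z i\<close> and \<open>z k\<close>; what remains is a nonnegative combination of
  total weight \<open>1 - 2 * c\<close>, to which only the triangle inequality is applied.
\<close>
lemma norm_convex_combination_le_pair:
  fixes z :: "'i \<Rightarrow> 'a::real_normed_vector"
  assumes J: "finite J" "i \<in> J" "k \<in> J" "i \<noteq> k"
    and w: "\<And>j. j \<in> J \<Longrightarrow> 0 \<le> w j" "c \<le> w i" "c \<le> w k" "(\<Sum>j\<in>J. w j) = 1"
    and c: "0 \<le> c"
    and R: "\<And>j. j \<in> J \<Longrightarrow> norm (z j) \<le> R"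
  shows "norm (\<Sum>j\<in>J. w j *\<^sub>R z j) \<le> c * norm (z i + z k) + (1 - 2 * c) * R"
proof -
  define v where "v j = (if j = i then c else 0) + (if j = k then c else 0)" for j
  have v: "v j \<le> w j" if "j \<in> J" for j
    using w J that by (auto simp: v_def)
  have sum_v: "(\<Sum>j\<in>J. v j) = 2 * c" using J by (simp add: v_def sum.distrib)
  have sum_vz: "(\<Sum>j\<in>J. v j *\<^sub>R z j) = c *\<^sub>R (z i + z k)"
  proof -
    have "v j *\<^sub>R z j = (if j = i then c *\<^sub>R z j else 0) + (if j = k then c *\<^sub>R z j else 0)" for j
      by (simp add: v_def scaleR_left_distrib)
    then show ?thesis using J by (simp add: sum.distrib scaleR_right_distrib)
  qed
  have "(\<Sum>j\<in>J. w j *\<^sub>R z j) = c *\<^sub>R (z i + z k) + (\<Sum>j\<in>J. (w j - v j) *\<^sub>R z j)"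
    by (simp add: scaleR_left_diff_distrib sum_subtractf sum_vz)
  also have "norm \<dots> \<le> norm (c *\<^sub>R (z i + z k)) + norm (\<Sum>j\<in>J. (w j - v j) *\<^sub>R z j)"
    by (rule norm_triangle_ineq)
  also have "norm (\<Sum>j\<in>J. (w j - v j) *\<^sub>R z j) \<le> (\<Sum>j\<in>J. (w j - v j) * R)"
    using v R by (intro sum_norm_le) (auto intro!: mult_left_mono)
  also have "\<dots> = (1 - 2 * c) * R"
    by (simp add: sum_distrib_right[symmetric] sum_subtractf w sum_v)
  finally show ?thesis using c by simp
qed

text \<open>
  Rescaling a vector whose length tends to \<open>r\<close> by \<open>1 / r\<close> or by the inverse of its own length makes
  asymptotically no difference. This reduces vectors of nearly equal length to unit vectors.
\<close>
lemma sgn_diff_scaled_tendsto_0: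
  fixes u :: "nat \<Rightarrow> 'a::real_normed_vector"
  assumes "(\<lambda>n. norm (u n)) \<longlonglongrightarrow> r" and "0 < r"
  shows "(\<lambda>n. norm (sgn (u n) - u n /\<^sub>R r)) \<longlonglongrightarrow> 0"
proof -
  have "norm (sgn (u n) - u n /\<^sub>R r) = \<bar>1 - norm (u n) / r\<bar>" if "0 < norm (u n)" for n
  proof -
    have "sgn (u n) - u n /\<^sub>R r = (inverse (norm (u n)) - inverse r) *\<^sub>R u n"
      by (simp add: sgn_div_norm scaleR_left_diff_distrib)
    then have "norm (sgn (u n) - u n /\<^sub>R r) = \<bar>(inverse (norm (u n)) - inverse r) * norm (u n)\<bar>"
      by (simp add: abs_mult)
    also have "(inverse (norm (u n)) - inverse r) * norm (u n) = 1 - norm (u n) / r"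
      using that by (simp add: field_simps)
    finally show ?thesis .
  qed
  then have "\<forall>\<^sub>F n in sequentially. \<bar>1 - norm (u n) / r\<bar> = norm (sgn (u n) - u n /\<^sub>R r)"
    using order_tendstoD(1)[OF assms] by (auto elim!: eventually_mono)
  moreover have "(\<lambda>n. \<bar>1 - norm (u n) / r\<bar>) \<longlonglongrightarrow> \<bar>1 - r / r\<bar>"
    using assms by (intro tendsto_intros) auto
  ultimately show ?thesis using assms(2) by (auto dest: Lim_transform_eventually)
qed

text \<open>
  If the midpoint is asymptotically as long as the bound \<open>R\<close> on the two vectors, both
  lengths tend to \<open>r\<close>. For \<open>r = 0\<close> the claim is then trivial; otherwise the directions of the two
  vectors are unit vectors whose midpoints have length tending to 1, so uniform convexity brings
  these directions together.
\<close>
lemma uniformly_convex_sequences: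
  fixes u v :: "nat \<Rightarrow> 'a::uniformly_convex_space"
  assumes u: "\<And>n. norm (u n) \<le> R n" and v: "\<And>n. norm (v n) \<le> R n"
    and s: "\<And>n. s n \<le> norm (u n + v n) / 2"
    and R: "R \<longlonglongrightarrow> r" and s_lim: "s \<longlonglongrightarrow> r"
  shows "(\<lambda>n. norm (u n - v n)) \<longlonglongrightarrow> 0"
proof -
  have lo: "(\<lambda>n. 2 * s n - R n) \<longlonglongrightarrow> r"
    using tendsto_diff[OF tendsto_mult[OF tendsto_const[of 2] s_lim] R] by simp
  have lower: "2 * s n - R n \<le> norm (u n)" "2 * s n - R n \<le> norm (v n)" for n
    using norm_triangle_ineq[of "u n" "v n"] u[of n] v[of n] s[of n] by linarith+
  have u_lim: "(\<lambda>n. norm (u n)) \<longlonglongrightarrow> r" and v_lim: "(\<lambda>n. norm (v n)) \<longlonglongrightarrow> r"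
    by (rule tendsto_sandwich[OF _ _ lo R]; simp add: lower u v)+
  have "0 \<le> r" using u_lim by (rule LIMSEQ_le_const) auto
  show ?thesis
  proof (cases "r = 0")
    case True
    have "(\<lambda>n. norm (u n) + norm (v n)) \<longlonglongrightarrow> 0"
      using tendsto_add[OF u_lim v_lim] True by simp
    then show ?thesis
      by (rule tendsto_sandwich[OF _ _ tendsto_const, rotated 2]) (simp_all add: norm_triangle_ineq4)
  next
    case False
    with \<open>0 \<le> r\<close> have "0 < r" by simp
    define E where "E n = norm (sgn (u n) - u n /\<^sub>R r) + norm (sgn (v n) - v n /\<^sub>R r)" for n
    have E_lim: "E \<longlonglongrightarrow> 0"
      unfolding E_def
      using tendsto_add[OF sgn_diff_scaled_tendsto_0[OF u_lim \<open>0 < r\<close>]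
          sgn_diff_scaled_tendsto_0[OF v_lim \<open>0 < r\<close>]] by simp
    have mid: "s n / r - E n \<le> norm ((1/2) *\<^sub>R (sgn (u n) + sgn (v n)))" for n
    proof -
      have "(u n + v n) /\<^sub>R r = (sgn (u n) + sgn (v n))
          - ((sgn (u n) - u n /\<^sub>R r) + (sgn (v n) - v n /\<^sub>R r))"
        by (simp add: scaleR_right_distrib)
      then have "norm ((u n + v n) /\<^sub>R r) \<le> norm (sgn (u n) + sgn (v n)) + E n"
        unfolding E_def by (metis add_left_mono norm_triangle_ineq norm_triangle_ineq4 order_trans)
      moreover have "norm ((u n + v n) /\<^sub>R r) = norm (u n + v n) / r"
        using \<open>0 < r\<close> by (simp add: divide_inverse mult.commute)
      moreover have "2 * (s n / r) \<le> norm (u n + v n) / r"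
        using s[of n] \<open>0 < r\<close> by (simp add: field_simps)
      moreover have "0 \<le> E n" by (simp add: E_def)
      moreover have "norm ((1/2) *\<^sub>R (sgn (u n) + sgn (v n))) = norm (sgn (u n) + sgn (v n)) / 2"
        by simp
      ultimately show ?thesis by linarith
    qed
    have mid_lim: "(\<lambda>n. s n / r - E n) \<longlonglongrightarrow> 1"
      using tendsto_diff[OF tendsto_divide[OF s_lim tendsto_const[of r]] E_lim] \<open>0 < r\<close> by simp
    have diff: "norm (u n - v n) \<le> r * (norm (sgn (u n) - sgn (v n)) + E n)" for n
    proof -
      have "(u n - v n) /\<^sub>R r = (sgn (u n) - sgn (v n))
          - ((sgn (u n) - u n /\<^sub>R r) - (sgn (v n) - v n /\<^sub>R r))"
        by (simp add: scaleR_right_diff_distrib)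
      then have "norm ((u n - v n) /\<^sub>R r) \<le> norm (sgn (u n) - sgn (v n)) + E n"
        unfolding E_def by (metis add_left_mono norm_triangle_ineq4 order_trans)
      moreover have "norm ((u n - v n) /\<^sub>R r) = norm (u n - v n) / r"
        using \<open>0 < r\<close> by (simp add: divide_inverse mult.commute)
      ultimately have "norm (u n - v n) / r \<le> norm (sgn (u n) - sgn (v n)) + E n" by linarith
      then show ?thesis using \<open>0 < r\<close> by (simp add: pos_divide_le_eq mult.commute)
    qed
    have sgn_lim: "(\<lambda>n. norm (sgn (u n) - sgn (v n))) \<longlonglongrightarrow> 0"
    proof (rule order_tendstoI)
      fix e :: real assume "0 < e"
      \<comment> \<open>The modulus of convexity is given only for separations up to 2.\<close>
      define e' where "e' = min e 2"
      have "0 < e'" "e' \<le> 2" "e' \<le> e" using \<open>0 < e\<close> by (auto simp: e'_def)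
      with uniformly_convex[where 'a='a] obtain \<delta> where "\<delta> > 0" and
        \<delta>: "\<And>x y :: 'a. norm x = 1 \<Longrightarrow> norm y = 1 \<Longrightarrow> norm (x - y) \<ge> e' \<Longrightarrow>
              norm ((1/2) *\<^sub>R (x + y)) \<le> 1 - \<delta>"
        by meson
      have "\<forall>\<^sub>F n in sequentially. 1 - \<delta> < s n / r - E n"
        using mid_lim \<open>\<delta> > 0\<close> by (intro order_tendstoD(1)) auto
      moreover have "\<forall>\<^sub>F n in sequentially. 0 < norm (u n)"
        using u_lim \<open>0 < r\<close> by (rule order_tendstoD(1))
      moreover have "\<forall>\<^sub>F n in sequentially. 0 < norm (v n)"
        using v_lim \<open>0 < r\<close> by (rule order_tendstoD(1))
      ultimately show "\<forall>\<^sub>F n in sequentially. norm (sgn (u n) - sgn (v n)) < e"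
      proof eventually_elim
        case (elim n)
        show ?case
        proof (rule ccontr)
          assume "\<not> norm (sgn (u n) - sgn (v n)) < e"
          then have "norm ((1/2) *\<^sub>R (sgn (u n) + sgn (v n))) \<le> 1 - \<delta>"
            using elim \<open>e' \<le> e\<close> by (intro \<delta>) (auto simp: norm_sgn)
          with mid[of n] elim show False by linarith
        qed
      qed
    qed (simp add: order_less_le_trans[OF _ norm_ge_zero])
    have "(\<lambda>n. r * (norm (sgn (u n) - sgn (v n)) + E n)) \<longlonglongrightarrow> 0"
      using tendsto_mult[OF tendsto_const[of r] tendsto_add[OF sgn_lim E_lim]] by simp
    then show ?thesis
      by (rule tendsto_sandwich[OF _ _ tendsto_const, rotated 2]) (simp_all add: diff)
  qed
qed

section \<open>Total asymptotically nonexpansive mappings\<close>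

lemma funpow_fixed_point: "f p = p \<Longrightarrow> (f ^^ n) p = p"
  by (induction n) auto

lemma funpow_in: "f \<in> K \<rightarrow> K \<Longrightarrow> y \<in> K \<Longrightarrow> (f ^^ n) y \<in> K"
  by (induction n) auto

text \<open>
  The defining inequality is nonlinear in the distance. Below the threshold \<open>M\<close> monotonicity bounds
  \<open>\<phi>\<close> by \<open>\<phi> M\<close>, above it \<open>\<phi>\<close> is linearly bounded, so \<open>\<phi> t \<le> M' * t + \<phi> M\<close> throughout.
\<close>
lemma total_asymptotically_nonexpansive_affine_bound:
  assumes T: "total_asymptotically_nonexpansive K T \<mu> l \<phi>"
    and "0 < M" and "0 < M'" and lin: "\<forall>t\<ge>M. \<phi> t \<le> M' * t"
    and p: "p \<in> fixed_points K T" and "y \<in> K" and "1 \<le> n"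
  shows "norm ((T ^^ n) y - p) \<le> (1 + M' * \<mu> n) * norm (y - p) + (\<phi> M * \<mu> n + l n)"
proof -
  let ?t = "norm (y - p)"
  have "\<phi> ?t \<le> M' * ?t + \<phi> M"
  proof (cases "M \<le> ?t")
    case True
    have "0 \<le> \<phi> M" using T \<open>0 < M\<close> by (auto simp: total_asymptotically_nonexpansive_def)
    with True lin show ?thesis by fastforce
  next
    case False
    have "strict_mono_on {0..} \<phi>" using T by (simp add: total_asymptotically_nonexpansive_def)
    then have "\<phi> ?t \<le> \<phi> M" using False \<open>0 < M\<close>
      by (intro less_imp_le strict_mono_onD[of "{0..}" \<phi>]) auto
    moreover have "0 \<le> M' * ?t" using \<open>0 < M'\<close> by simp
    ultimately show ?thesis by simp
  qed
  moreover have "0 \<le> \<mu> n" using T \<open>1 \<le> n\<close> by (simp add: total_asymptotically_nonexpansive_def)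
  ultimately have "\<mu> n * \<phi> ?t \<le> \<mu> n * (M' * ?t + \<phi> M)" by (rule mult_left_mono)
  moreover have "norm ((T ^^ n) y - (T ^^ n) p) \<le> ?t + \<mu> n * \<phi> ?t + l n"
    using T p \<open>y \<in> K\<close> \<open>1 \<le> n\<close>
    by (simp add: total_asymptotically_nonexpansive_def fixed_points_def)
  moreover have "(T ^^ n) p = p" using p by (simp add: fixed_points_def funpow_fixed_point)
  ultimately show ?thesis by (simp add: algebra_simps)
qed

theorem theorem11:
  fixes K :: "'a::{uniformly_convex_space, banach} set"
    and m :: nat
    and T :: "nat \<Rightarrow> 'a \<Rightarrow> 'a"
    and \<mu> l :: "nat \<Rightarrow> nat \<Rightarrow> real"
    and \<phi> :: "nat \<Rightarrow> real \<Rightarrow> real"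
    and \<alpha> :: "nat \<Rightarrow> nat \<Rightarrow> real"
    and \<gamma>\<^sub>1 \<gamma>\<^sub>2 :: real
    and x :: "nat \<Rightarrow> 'a"
  assumes "1 \<le> m"
    and "K \<noteq> {}" and "closed K" and "convex K"
    and "\<And>i. i \<in> {1..m} \<Longrightarrow> total_asymptotically_nonexpansive K (T i) (\<mu> i) (l i) (\<phi> i)"
    and "\<And>i. i \<in> {1..m} \<Longrightarrow> summable (\<lambda>n. \<mu> i (Suc n))"
    and "\<And>i. i \<in> {1..m} \<Longrightarrow> summable (\<lambda>n. l i (Suc n))"
    and "(\<Inter>i\<in>{1..m}. fixed_points K (T i)) \<noteq> {}"
    and "\<gamma>\<^sub>1 \<in> {0<..<1}" and "\<gamma>\<^sub>2 \<in> {0<..<1}"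
    and "\<And>i n. i \<in> {0..m} \<Longrightarrow> n \<ge> 1 \<Longrightarrow> \<alpha> i n \<in> {\<gamma>\<^sub>1<..<\<gamma>\<^sub>2}"
    and "\<And>n. n \<ge> 1 \<Longrightarrow> (\<Sum>i=0..m. \<alpha> i n) = 1"
    and "x 1 \<in> K"
    and "\<And>n. n \<ge> 1 \<Longrightarrow>
           x (Suc n) = \<alpha> 0 n *\<^sub>R x n + (\<Sum>i=1..m. \<alpha> i n *\<^sub>R (T i ^^ n) (x n))"
    and "\<And>i. i \<in> {1..m} \<Longrightarrow>
           \<exists>M>0. \<exists>M'>0. \<forall>t\<ge>M. \<phi> i t \<le> M' * t"
  shows "\<forall>i\<in>{1..m}. (\<lambda>n. norm (x n - (T i ^^ n) (x n))) \<longlonglongrightarrow> 0"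
proof -
  note \<alpha> = assms(11) and sum_\<alpha> = assms(12) and rec = assms(14)
  have TAN: "total_asymptotically_nonexpansive K (T i) (\<mu> i) (l i) (\<phi> i)" if "i \<in> {1..m}" for i
    using assms(5) that .
  have \<alpha>_pos: "0 < \<alpha> j n" if "j \<in> {0..m}" "n \<ge> 1" for j n
    using \<alpha>[OF that] assms(9) by auto
  obtain p where p: "\<And>i. i \<in> {1..m} \<Longrightarrow> p \<in> fixed_points K (T i)" using assms(8) by blast
  have "\<forall>i\<in>{1..m}. \<exists>M M'. 0 < M \<and> 0 < M' \<and> (\<forall>t\<ge>M. \<phi> i t \<le> M' * t)"
    using assms(15) by blast
  then obtain M M' where M: "\<And>i. i \<in> {1..m} \<Longrightarrow> 0 < M i \<and> 0 < M' i \<and> (\<forall>t\<ge>M i. \<phi> i t \<le> M' i * t)"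
    by metis

  \<comment> \<open>The \<open>m + 1\<close> points averaged at stage \<open>n\<close>; index 0 stands for \<open>x n\<close> itself.\<close>
  define z where "z n j = (if j = 0 then x n else (T j ^^ n) (x n))" for n j
  have x_Suc: "x (Suc n) = (\<Sum>j=0..m. \<alpha> j n *\<^sub>R z n j)" if "n \<ge> 1" for n
    by (simp add: rec[OF that] z_def sum.atLeast_Suc_atMost)
  have z_in: "z n j \<in> K" if "x n \<in> K" "j \<in> {0..m}" for n j
  proof (cases "j = 0")
    case False
    then have "T j \<in> K \<rightarrow> K"
      using TAN[of j] that by (simp add: total_asymptotically_nonexpansive_def)
    then show ?thesis using that False by (simp add: z_def funpow_in)
  qed (use that in \<open>simp add: z_def\<close>)
  have x_in: "x n \<in> K" if "n \<ge> 1" for n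
    using that
  proof (induction n rule: dec_induct)
    case (step n)
    then show ?case
      unfolding x_Suc[OF step(1)]
      using z_in sum_\<alpha>[of n] \<alpha>_pos[of _ n]
      by (intro convex_sum[OF _ \<open>convex K\<close>]) (auto intro: less_imp_le)
  qed (rule assms(13))

  \<comment> \<open>From here on sequences are indexed from 0 and stand for the stages \<open>Suc n\<close>. Summing the errors over
    all mappings gives one bound that serves every index \<open>j\<close>.\<close>
  define a where "a n = norm (x (Suc n) - p)" for n
  define b where "b n = (\<Sum>i=1..m. M' i * \<mu> i (Suc n))" for n
  define c where "c n = (\<Sum>i=1..m. \<phi> i (M i) * \<mu> i (Suc n) + l i (Suc n))" for n
  define R where "R n = (1 + b n) * a n + c n" for n
  have nonneg: "0 \<le> M' i * \<mu> i (Suc n)" "0 \<le> \<phi> i (M i) * \<mu> i (Suc n) + l i (Suc n)"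
    if "i \<in> {1..m}" for i n
    using TAN[OF that] M[OF that]
    by (auto simp: total_asymptotically_nonexpansive_def Pi_iff intro!: mult_nonneg_nonneg add_nonneg_nonneg)
  have a_nonneg: "0 \<le> a n" for n by (simp add: a_def)
  have b_nonneg: "0 \<le> b n" and c_nonneg: "0 \<le> c n" for n
    using nonneg by (auto simp: b_def c_def intro!: sum_nonneg)
  have b_sum: "summable b" and c_sum: "summable c"
    unfolding b_def c_def using assms(6,7)
    by (auto intro!: summable_sum summable_mult summable_add)
  have z_bound: "norm (z (Suc n) j - p) \<le> R n" if "j \<in> {0..m}" for n j
  proof (cases "j = 0")
    case True
    have "0 \<le> b n * a n" using a_nonneg b_nonneg by simp
    with True c_nonneg[of n] show ?thesis by (simp add: z_def R_def a_def algebra_simps)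
  next
    case False
    then have j: "j \<in> {1..m}" using that by simp
    have "norm ((T j ^^ Suc n) (x (Suc n)) - p)
        \<le> (1 + M' j * \<mu> j (Suc n)) * a n + (\<phi> j (M j) * \<mu> j (Suc n) + l j (Suc n))"
      unfolding a_def using M[OF j]
      by (intro total_asymptotically_nonexpansive_affine_bound[OF TAN[OF j]] p[OF j] x_in) auto
    also have "\<dots> \<le> R n"
    proof -
      have "M' j * \<mu> j (Suc n) \<le> b n"
        unfolding b_def using nonneg(1) by (intro member_le_sum[OF j]) auto
      moreover have "\<phi> j (M j) * \<mu> j (Suc n) + l j (Suc n) \<le> c n"
        unfolding c_def using nonneg(2) by (intro member_le_sum[OF j]) auto
      ultimately show ?thesis
        unfolding R_def using a_nonneg[of n] by (intro add_mono mult_right_mono) auto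
    qed
    finally show ?thesis using False by (simp add: z_def)
  qed
  have x_diff: "x (Suc (Suc n)) - p = (\<Sum>j=0..m. \<alpha> j (Suc n) *\<^sub>R (z (Suc n) j - p))" for n
    using sum_\<alpha>[of "Suc n"]
    by (simp add: x_Suc scaleR_right_diff_distrib sum_subtractf flip: scaleR_left.sum)
  have pair: "a (Suc n) \<le> \<gamma> * norm ((z (Suc n) 0 - p) + (z (Suc n) i - p)) + (1 - 2 * \<gamma>) * R n"
    if "i \<in> {1..m}" "0 \<le> \<gamma>" "\<gamma> \<le> \<gamma>\<^sub>1" for i n \<gamma>
    unfolding a_def x_diff
  proof (rule norm_convex_combination_le_pair)
    show "0 \<le> \<alpha> j (Suc n)" if "j \<in> {0..m}" for j
      using \<alpha>_pos[OF that, of "Suc n"] by simp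
    show "\<gamma> \<le> \<alpha> 0 (Suc n)" "\<gamma> \<le> \<alpha> i (Suc n)"
      using \<alpha>[of 0 "Suc n"] \<alpha>[of i "Suc n"] that by auto
    show "norm (z (Suc n) j - p) \<le> R n" if "j \<in> {0..m}" for j
      using that by (rule z_bound)
    show "(\<Sum>j=0..m. \<alpha> j (Suc n)) = 1" by (rule sum_\<alpha>) simp
  qed (use that in auto)
  \<comment> \<open>Splitting off weight 0 leaves the plain triangle inequality.\<close>
  have "a (Suc n) \<le> R n" for n using pair[of 1 0 n] assms(1,9) by simp
  then have "convergent a"
    using a_nonneg b_nonneg c_nonneg b_sum c_sum
    by (intro convergent_if_quasi_decreasing[of a b c]) (auto simp: R_def)
  then obtain r where a_lim: "a \<longlonglongrightarrow> r" by (auto simp: convergent_def)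
  have R_lim: "R \<longlonglongrightarrow> r"
  proof -
    have "(\<lambda>n. (1 + b n) * a n + c n) \<longlonglongrightarrow> (1 + 0) * r + 0"
      by (intro tendsto_intros a_lim summable_LIMSEQ_zero b_sum c_sum)
    then show ?thesis by (simp add: R_def[abs_def])
  qed

  show ?thesis
  proof
    fix i assume i: "i \<in> {1..m}"
    have "0 < \<gamma>\<^sub>1" using assms(9) by simp
    \<comment> \<open>The lower bound for the length of the midpoint that \<open>pair\<close> yields with \<open>\<gamma> = \<gamma>\<^sub>1\<close>.\<close>
    define s where "s n = (a (Suc n) - (1 - 2 * \<gamma>\<^sub>1) * R n) / (2 * \<gamma>\<^sub>1)" for n
    have "(\<lambda>n. (a (Suc n) - (1 - 2 * \<gamma>\<^sub>1) * R n) / (2 * \<gamma>\<^sub>1)) \<longlonglongrightarrow> (r - (1 - 2 * \<gamma>\<^sub>1) * r) / (2 * \<gamma>\<^sub>1)"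
      using \<open>0 < \<gamma>\<^sub>1\<close> by (intro tendsto_intros LIMSEQ_Suc[OF a_lim] R_lim) auto
    then have s_lim: "s \<longlonglongrightarrow> r" using \<open>0 < \<gamma>\<^sub>1\<close> by (simp add: s_def[abs_def] field_simps)
    have "(\<lambda>n. norm ((z (Suc n) 0 - p) - (z (Suc n) i - p))) \<longlonglongrightarrow> 0"
    proof (rule uniformly_convex_sequences[OF _ _ _ R_lim s_lim])
      show "s n \<le> norm ((z (Suc n) 0 - p) + (z (Suc n) i - p)) / 2" for n
        using pair[OF i, of \<gamma>\<^sub>1 n] \<open>0 < \<gamma>\<^sub>1\<close> by (simp add: s_def field_simps)
    qed (use i in \<open>auto intro!: z_bound\<close>)
    then have "(\<lambda>n. norm (x (Suc n) - (T i ^^ Suc n) (x (Suc n)))) \<longlonglongrightarrow> 0"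
      using i by (simp add: z_def)
    then show "(\<lambda>n. norm (x n - (T i ^^ n) (x n))) \<longlonglongrightarrow> 0"
      by (rule LIMSEQ_imp_Suc)
  qed
qed

end
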